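(* Let $n\ge 2$ be an integer, let $\varrho\in S_n$ be an arbitrary permutation, and let $i,j\in\{1,\dots,n\}$ with $i<j$. Then the $(i,j)$ entry of the matrix $\overline{F}(\varrho)$ satisfies $\overline{F}(\varrho)[i,j]\in\{0,1\}$.
   Context: $B_n$ is the braid group on $n$ strands, with presentation by the Artin generators $\sigma_1,\dots,\sigma_{n-1}$ subject to $\sigma_i\sigma_{i+1}\sigma_i=\sigma_{i+1}\sigma_i\sigma_{i+1}$ for all $1\le i\le n-2$ and $\sigma_i\sigma_j=\sigma_j\sigma_i$ whenever $|i-j|>1$. The permutation of a braid is its image $s_\beta$ under the surjective homomorphism $B_n\to S_n$, $\sigma_i\mapsto(i,i+1)$. Elements of $\mathbb{Z}^{n(n-1)}$ are regarded as $n\times n$ integer matrices with zero diagonal; $O_{i,j}$ denotes the matrix with entry $1$ at position $(i,j)$ and $0$ elsewhere. $S_n$ acts on these matrices linearly with $\pi\cdot O_{i,j}=O_{\pi(i),\pi(j)}$, and $\mathbb{Z}^{n(n-1)}\rtimes S_n$ has group law $(M,\pi)(M',\pi')=(M+\pi\cdot M',\pi\pi')$. The super-Gauss-Epple homomorphism $SGE:B_n\to\mathbb{Z}^{n(n-1)}\rtimes S_n$ is the group homomorphism determined by $SGE(\sigma_i)=(O_{i,i+1},(i,i+1))$ for $1\le i\le n-1$. Define $F:B_n\to M_{n,n}(\mathbb{Z})$ by $F(\beta)=M-M^T$ where $SGE(\beta)=(M,s_\beta)$. The value $F(\beta)$ depends only on the permutation $s_\beta$, so $F$ descends to a map $\overline{F}:S_n\to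 M_{n,n}(\mathbb{Z})$ with $\overline{F}(s_\beta)=F(\beta)$ for all $\beta\in B_n$. *)

theory Defs
  imports "HOL-Algebra.Sym_Groups"
begin

section \<open>The braid group\<close>

text \<open>
  A letter \<open>(i, True)\<close> stands for the Artin generator \<open>\<sigma>\<^sub>i\<close> and \<open>(i, False)\<close> for its
  inverse. The braid group is the set of words modulo the least congruence containing free
  cancellation and the braid relations.
\<close>

type_synonym braid_word = "(nat \<times> bool) list"

definition braid_words :: "nat \<Rightarrow> braid_word set" where
  "braid_words n = lists ({1..<n} \<times> UNIV)"

inductive_set braid_rel :: "nat \<Rightarrow> (braid_word \<times> braid_word) set" for n :: nat where
  refl: "u \<in> braid_words n \<Longrightarrow> (u, u) \<in> braid_rel n"
| sym: "(u, v) \<in> braid_rel n \<Longrightarrow> (v, u) \<in> braid_rel n"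
| trans: "(u, v) \<in> braid_rel n \<Longrightarrow> (v, w) \<in> braid_rel n \<Longrightarrow> (u, w) \<in> braid_rel n"
| append: "(u, u') \<in> braid_rel n \<Longrightarrow> (v, v') \<in> braid_rel n \<Longrightarrow> (u @ v, u' @ v') \<in> braid_rel n"
| cancel: "i \<in> {1..<n} \<Longrightarrow> ([(i, e), (i, \<not> e)], []) \<in> braid_rel n"
| braid: "1 \<le> i \<Longrightarrow> i + 1 < n \<Longrightarrow>
    ([(i, True), (i + 1, True), (i, True)], [(i + 1, True), (i, True), (i + 1, True)]) \<in> braid_rel n"
| commute: "i \<in> {1..<n} \<Longrightarrow> j \<in> {1..<n} \<Longrightarrow> i + 1 < j \<or> j + 1 < i \<Longrightarrow>
    ([(i, True), (j, True)], [(j, True), (i, True)]) \<in> braid_rel n"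

definition braid_group :: "nat \<Rightarrow> braid_word set monoid" where
  "braid_group n =
    \<lparr> carrier = braid_words n // braid_rel n,
      mult = (\<lambda>A B. \<Union>u\<in>A. \<Union>v\<in>B. braid_rel n `` {u @ v}),
      one = braid_rel n `` {[]} \<rparr>"

definition artin_gen :: "nat \<Rightarrow> nat \<Rightarrow> braid_word set" where
  "artin_gen n i = braid_rel n `` {[(i, True)]}"

lemma braid_words_append [simp]:
  "u @ v \<in> braid_words n \<longleftrightarrow> u \<in> braid_words n \<and> v \<in> braid_words n"
  by (auto simp: braid_words_def)

lemma braid_words_Nil [simp]: "[] \<in> braid_words n"
  by (auto simp: braid_words_def)

lemma braid_words_Cons [simp]:
  "x # u \<in> braid_words n \<longleftrightarrow> fst x \<in> {1..<n} \<and> u \<in> braid_words n"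
  by (cases x) (auto simp: braid_words_def)

lemma braid_rel_words: "(u, v) \<in> braid_rel n \<Longrightarrow> u \<in> braid_words n \<and> v \<in> braid_words n"
  by (induction rule: braid_rel.induct) auto

lemma equiv_braid_rel: "equiv (braid_words n) (braid_rel n)"
proof (rule equivI)
  show "braid_rel n \<subseteq> braid_words n \<times> braid_words n"
    using braid_rel_words by auto
  show "refl_on (braid_words n) (braid_rel n)"
    by (auto intro!: refl_onI braid_rel.refl)
  show "Relation.sym (braid_rel n)"
    by (rule symI) (rule braid_rel.sym)
  show "Relation.trans (braid_rel n)"
    by (rule transI) (rule braid_rel.trans)
qed

lemma braid_class_eq_iff:
  assumes "u \<in> braid_words n" "v \<in> braid_words n"
  shows "braid_rel n `` {u} = braid_rel n `` {v} \<longleftrightarrow> (u, v) \<in> braid_rel n"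
  using eq_equiv_class_iff[OF equiv_braid_rel assms] .

lemma braid_carrierE:
  assumes "x \<in> carrier (braid_group n)"
  obtains u where "u \<in> braid_words n" "x = braid_rel n `` {u}"
  using assms by (auto simp: braid_group_def elim: quotientE)

lemma braid_class_carrier: "u \<in> braid_words n \<Longrightarrow> braid_rel n `` {u} \<in> carrier (braid_group n)"
  by (auto simp: braid_group_def intro: quotientI)

lemma braid_mult_class:
  assumes "u \<in> braid_words n" "v \<in> braid_words n"
  shows "braid_rel n `` {u} \<otimes>\<^bsub>braid_group n\<^esub> braid_rel n `` {v} = braid_rel n `` {u @ v}"
proof -
  have "(\<lambda>u v. braid_rel n `` {u @ v}) respects2 braid_rel n"
  proof (rule congruent2I')
    fix u u' v v' assume "(u, u') \<in> braid_rel n" "(v, v') \<in> braid_rel n"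
    then show "braid_rel n `` {u @ v} = braid_rel n `` {u' @ v'}"
      by (intro equiv_class_eq[OF equiv_braid_rel] braid_rel.append)
  qed
  then show ?thesis
    using UN_equiv_class2[OF equiv_braid_rel equiv_braid_rel _ assms]
    by (simp add: braid_group_def)
qed

lemma braid_one_class: "\<one>\<^bsub>braid_group n\<^esub> = braid_rel n `` {[]}"
  by (simp add: braid_group_def)

lemma braid_inverse_word:
  "u \<in> braid_words n \<Longrightarrow>
    rev (map (\<lambda>(i, e). (i, \<not> e)) u) \<in> braid_words n \<and>
    (rev (map (\<lambda>(i, e). (i, \<not> e)) u) @ u, []) \<in> braid_rel n"
proof (induction u)
  case Nil
  then show ?case by (auto intro: braid_rel.refl)
next
  case (Cons x u)
  obtain i e where x: "x = (i, e)" by (cases x)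
  let ?r = "rev (map (\<lambda>(i, e). (i, \<not> e)) u)"
  have i: "i \<in> {1..<n}" and u: "u \<in> braid_words n"
    using Cons.prems x by auto
  note IH = Cons.IH[OF u]
  have "([(i, \<not> e), (i, \<not> \<not> e)], []) \<in> braid_rel n"
    by (rule braid_rel.cancel) (rule i)
  then have "(?r @ [(i, \<not> e), (i, e)] @ u, ?r @ [] @ u) \<in> braid_rel n"
    using IH u by (intro braid_rel.append braid_rel.refl) auto
  with IH have "(?r @ [(i, \<not> e), (i, e)] @ u, []) \<in> braid_rel n"
    by (auto intro: braid_rel.trans)
  then show ?case using IH i x by auto
qed

lemma group_braid_group: "group (braid_group n)"
proof (rule groupI)
  fix x y assume "x \<in> carrier (braid_group n)" "y \<in> carrier (braid_group n)"
  then obtain u v where "u \<in> braid_words n" "x = braid_rel n `` {u}"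
      "v \<in> braid_words n" "y = braid_rel n `` {v}"
    by (elim braid_carrierE)
  then show "x \<otimes>\<^bsub>braid_group n\<^esub> y \<in> carrier (braid_group n)"
    by (simp add: braid_mult_class braid_class_carrier)
next
  show "\<one>\<^bsub>braid_group n\<^esub> \<in> carrier (braid_group n)"
    by (simp add: braid_one_class braid_class_carrier)
next
  fix x y z assume "x \<in> carrier (braid_group n)" "y \<in> carrier (braid_group n)"
    "z \<in> carrier (braid_group n)"
  then obtain u v w where "u \<in> braid_words n" "x = braid_rel n `` {u}"
      "v \<in> braid_words n" "y = braid_rel n `` {v}" "w \<in> braid_words n" "z = braid_rel n `` {w}"
    by (elim braid_carrierE)
  then show "x \<otimes>\<^bsub>braid_group n\<^esub> y \<otimes>\<^bsub>braid_group n\<^esub> z = x \<otimes>\<^bsub>braid_group n\<^esub> (y \<otimes>\<^bsub>braid_group n\<^esub> z)"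
    by (simp add: braid_mult_class)
next
  fix x assume "x \<in> carrier (braid_group n)"
  then obtain u where u: "u \<in> braid_words n" "x = braid_rel n `` {u}"
    by (elim braid_carrierE)
  then show "\<one>\<^bsub>braid_group n\<^esub> \<otimes>\<^bsub>braid_group n\<^esub> x = x"
    by (simp add: braid_mult_class braid_one_class)
  let ?r = "rev (map (\<lambda>(i, e). (i, \<not> e)) u)"
  have r: "?r \<in> braid_words n" "(?r @ u, []) \<in> braid_rel n"
    using braid_inverse_word[OF u(1)] by auto
  show "\<exists>y\<in>carrier (braid_group n). y \<otimes>\<^bsub>braid_group n\<^esub> x = \<one>\<^bsub>braid_group n\<^esub>"
  proof (rule bexI[of _ "braid_rel n `` {?r}"])
    show "braid_rel n `` {?r} \<otimes>\<^bsub>braid_group n\<^esub> x = \<one>\<^bsub>braid_group n\<^esub>"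
      unfolding u(2) braid_mult_class[OF r(1) u(1)] braid_one_class
      using equiv_class_eq[OF equiv_braid_rel r(2)] .
  qed (rule braid_class_carrier[OF r(1)])
qed

section \<open>Homomorphisms out of the braid group\<close>

text \<open>
  The homomorphism out of the braid group determined by the images \<open>g i\<close> of the Artin
  generators. Functions on a carrier are taken to be \<open>extensional\<close>, so that a homomorphism is
  determined as a HOL function.
\<close>

definition braid_hom :: "nat \<Rightarrow> ('b, 'c) monoid_scheme \<Rightarrow> (nat \<Rightarrow> 'b) \<Rightarrow> braid_word set \<Rightarrow> 'b" where
  "braid_hom n G g =
    (THE h. h \<in> hom (braid_group n) G \<inter> extensional (carrier (braid_group n)) \<and>
            (\<forall>i\<in>{1..<n}. h (artin_gen n i) = g i))"

locale braid_images = group G for G (structure) +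
  fixes n :: nat and g :: "nat \<Rightarrow> 'a"
  assumes images_closed: "i \<in> {1..<n} \<Longrightarrow> g i \<in> carrier G"
    and images_braid: "1 \<le> i \<Longrightarrow> i + 1 < n \<Longrightarrow> g i \<otimes> (g (i + 1) \<otimes> g i) = g (i + 1) \<otimes> (g i \<otimes> g (i + 1))"
    and images_commute: "1 \<le> i \<Longrightarrow> i + 1 < j \<Longrightarrow> j < n \<Longrightarrow> g i \<otimes> g j = g j \<otimes> g i"
begin

definition letter :: "nat \<times> bool \<Rightarrow> 'a" where
  "letter x = (if snd x then g (fst x) else inv (g (fst x)))"

definition word_value :: "braid_word \<Rightarrow> 'a" where
  "word_value u = foldr (\<lambda>x y. letter x \<otimes> y) u \<one>"

lemma letter_closed: "fst x \<in> {1..<n} \<Longrightarrow> letter x \<in> carrier G"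
  by (simp add: letter_def images_closed)

lemma word_value_closed: "u \<in> braid_words n \<Longrightarrow> word_value u \<in> carrier G"
  by (induction u) (auto simp: word_value_def intro!: letter_closed m_closed)

lemma word_value_Nil: "word_value [] = \<one>"
  and word_value_Cons: "word_value (x # u) = letter x \<otimes> word_value u"
  by (simp_all add: word_value_def)

lemma word_value_append:
  "u \<in> braid_words n \<Longrightarrow> v \<in> braid_words n \<Longrightarrow> word_value (u @ v) = word_value u \<otimes> word_value v"
  by (induction u)
    (simp_all add: word_value_Nil word_value_Cons word_value_closed letter_closed m_assoc)

lemma word_value_cong: "(u, v) \<in> braid_rel n \<Longrightarrow> word_value u = word_value v"
proof (induction rule: braid_rel.induct)
  case (append u u' v v')
  then show ?case
    using braid_rel_words by (auto simp: word_value_append)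
next
  case (cancel i e)
  then show ?case
    by (cases e) (simp_all add: word_value_Nil word_value_Cons letter_def images_closed)
next
  case (braid i)
  then show ?case
    using images_braid[of i]
    by (simp add: word_value_Nil word_value_Cons letter_def images_closed)
next
  case (commute i j)
  then show ?case
    using images_commute[of i j] images_commute[of j i]
    by (auto simp: word_value_Nil word_value_Cons letter_def images_closed)
qed auto

lemma braid_hom_unique:
  assumes h: "h \<in> hom (braid_group n) G" "\<And>i. i \<in> {1..<n} \<Longrightarrow> h (artin_gen n i) = g i"
    and u: "u \<in> braid_words n"
  shows "h (braid_rel n `` {u}) = word_value u"
  using u
proof (induction u)
  case Nil
  have "h \<one>\<^bsub>braid_group n\<^esub> = \<one>"
    using h(1) group_braid_group is_group by (rule hom_one)
  then show ?case
    by (simp add: word_value_Nil braid_one_class)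
next
  case (Cons x u)
  interpret H: group_hom "braid_group n" G h
    using h(1) group_braid_group is_group
    by (simp add: group_hom_def group_hom_axioms_def)
  obtain i e where x: "x = (i, e)" by (cases x)
  have i: "i \<in> {1..<n}" and u: "u \<in> braid_words n"
    using Cons.prems x by auto
  have c: "braid_rel n `` {[(i, e)]} \<in> carrier (braid_group n)" for e
    using i by (intro braid_class_carrier) simp
  have "braid_rel n `` {[(i, False)]} \<otimes>\<^bsub>braid_group n\<^esub> artin_gen n i = \<one>\<^bsub>braid_group n\<^esub>"
    using i braid_rel.cancel[OF i, of False]
    by (simp add: artin_gen_def braid_mult_class braid_one_class braid_class_eq_iff)
  then have "inv\<^bsub>braid_group n\<^esub> artin_gen n i = braid_rel n `` {[(i, False)]}"
    using c by (intro group.inv_equality[OF group_braid_group]) (auto simp: artin_gen_def)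
  then have "h (braid_rel n `` {[(i, False)]}) = inv (g i)"
    using h(2)[OF i] H.hom_inv[of "artin_gen n i"] c[of True] by (simp add: artin_gen_def)
  then have "h (braid_rel n `` {[x]}) = letter x"
    using h(2)[OF i] x by (cases e) (simp_all add: letter_def artin_gen_def)
  moreover have "braid_rel n `` {x # u} = braid_rel n `` {[x]} \<otimes>\<^bsub>braid_group n\<^esub> braid_rel n `` {u}"
    using i u x by (simp add: braid_mult_class)
  ultimately show ?case
    using Cons.IH[OF u] c x u by (simp add: braid_class_carrier word_value_Cons)
qed

lemma ex1_braid_hom:
  "\<exists>!h. h \<in> hom (braid_group n) G \<inter> extensional (carrier (braid_group n)) \<and>
        (\<forall>i\<in>{1..<n}. h (artin_gen n i) = g i)"
proof (rule ex_ex1I)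
  define h where
    "h = restrict (\<lambda>x. the_elem (word_value ` x)) (carrier (braid_group n))"
  have h: "h (braid_rel n `` {u}) = word_value u" if u: "u \<in> braid_words n" for u
  proof -
    have "word_value ` (braid_rel n `` {u}) = {word_value u}"
      using braid_rel.refl[OF u] by (auto dest: word_value_cong)
    then show ?thesis
      using braid_class_carrier[OF u] by (simp add: h_def)
  qed
  have "h \<in> hom (braid_group n) G"
  proof (rule homI)
    fix x assume "x \<in> carrier (braid_group n)"
    then show "h x \<in> carrier G"
      by (elim braid_carrierE) (simp add: h word_value_closed)
  next
    fix x y assume "x \<in> carrier (braid_group n)" "y \<in> carrier (braid_group n)"
    then show "h (x \<otimes>\<^bsub>braid_group n\<^esub> y) = h x \<otimes> h y"
      by (elim braid_carrierE) (simp add: h braid_mult_class word_value_append)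
  qed
  moreover have "h (artin_gen n i) = g i" if "i \<in> {1..<n}" for i
    using that unfolding artin_gen_def
    by (subst h) (simp_all add: word_value_Nil word_value_Cons letter_def images_closed)
  ultimately show "\<exists>h. h \<in> hom (braid_group n) G \<inter> extensional (carrier (braid_group n)) \<and>
      (\<forall>i\<in>{1..<n}. h (artin_gen n i) = g i)"
    by (intro exI[of _ h]) (auto simp: h_def)
next
  fix h k
  assume h: "h \<in> hom (braid_group n) G \<inter> extensional (carrier (braid_group n)) \<and>
      (\<forall>i\<in>{1..<n}. h (artin_gen n i) = g i)"
    and k: "k \<in> hom (braid_group n) G \<inter> extensional (carrier (braid_group n)) \<and>
      (\<forall>i\<in>{1..<n}. k (artin_gen n i) = g i)"
  show "h = k"
  proof (rule extensionalityI[of _ "carrier (braid_group n)"])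
    fix x assume "x \<in> carrier (braid_group n)"
    then show "h x = k x"
      using h k braid_hom_unique[of h] braid_hom_unique[of k] by (elim braid_carrierE) auto
  qed (use h k in auto)
qed

lemma braid_hom_props:
  "braid_hom n G g \<in> hom (braid_group n) G"
  "i \<in> {1..<n} \<Longrightarrow> braid_hom n G g (artin_gen n i) = g i"
  using theI'[OF ex1_braid_hom] unfolding braid_hom_def by auto

end

section \<open>The permutation of a braid\<close>

definition braid_perm :: "nat \<Rightarrow> braid_word set \<Rightarrow> nat \<Rightarrow> nat" where
  "braid_perm n = braid_hom n (sym_group n) (\<lambda>i. Transposition.transpose i (i + 1))"

lemma transpose_braid:
  "Transposition.transpose i (Suc i) \<circ> (Transposition.transpose (Suc i) (Suc (Suc i)) \<circ> Transposition.transpose i (Suc i))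
   = Transposition.transpose (Suc i) (Suc (Suc i)) \<circ> (Transposition.transpose i (Suc i) \<circ> Transposition.transpose (Suc i) (Suc (Suc i)))"
  (is "?l = ?r")
proof
  fix x
  consider "x = i" | "x = Suc i" | "x = Suc (Suc i)" | "x \<noteq> i" "x \<noteq> Suc i" "x \<noteq> Suc (Suc i)"
    by blast
  then show "?l x = ?r x"
    by cases (simp_all add: Transposition.transpose_def)
qed

lemma transpose_far_commute:
  assumes "Suc i < j"
  shows "Transposition.transpose i (Suc i) \<circ> Transposition.transpose j (Suc j)
    = Transposition.transpose j (Suc j) \<circ> Transposition.transpose i (Suc i)" (is "?l = ?r")
proof
  fix x
  consider "x = i" | "x = Suc i" | "x = j" | "x = Suc j"
    | "x \<noteq> i" "x \<noteq> Suc i" "x \<noteq> j" "x \<noteq> Suc j"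
    by blast
  then show "?l x = ?r x"
    using assms by cases (simp_all add: Transposition.transpose_def)
qed

lemma braid_images_perm:
  "braid_images (sym_group n) n (\<lambda>i. Transposition.transpose i (i + 1))"
proof -
  interpret group "sym_group n" by (rule sym_group_is_group)
  show ?thesis
  proof unfold_locales
    fix i assume "i \<in> {1..<n}"
    then show "Transposition.transpose i (i + 1) \<in> carrier (sym_group n)"
      by (auto simp: sym_group_carrier intro!: permutes_swap_id)
  qed (simp_all add: sym_group_mult transpose_braid transpose_far_commute[symmetric])
qed

lemmas braid_perm_hom = braid_images.braid_hom_props(1)[OF braid_images_perm, folded braid_perm_def]
lemmas braid_perm_gen = braid_images.braid_hom_props(2)[OF braid_images_perm, folded braid_perm_def]

section \<open>Integer matrices and the semidirect product\<close>

text \<open>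
  Since the size \<open>n\<close> is a number rather than a type, an \<open>n \<times> n\<close> integer matrix is a function
  \<open>nat \<Rightarrow> nat \<Rightarrow> int\<close> that vanishes outside \<open>{1..n} \<times> {1..n}\<close>.
\<close>

type_synonym imat = "nat \<Rightarrow> nat \<Rightarrow> int"

definition zero_diag_mats :: "nat \<Rightarrow> imat set" where
  "zero_diag_mats n = {M. (\<forall>a b. M a b \<noteq> 0 \<longrightarrow> a \<in> {1..n} \<and> b \<in> {1..n}) \<and> (\<forall>a. M a a = 0)}"

definition mat_unit :: "nat \<Rightarrow> nat \<Rightarrow> imat" where
  "mat_unit i j = (\<lambda>a b. if a = i \<and> b = j then 1 else 0)"

definition mat_plus :: "imat \<Rightarrow> imat \<Rightarrow> imat" where
  "mat_plus M N = (\<lambda>a b. M a b + N a b)"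

text \<open>
  The linear action sending the matrix unit at \<open>(i, j)\<close> to the one at \<open>(\<pi> i, \<pi> j)\<close> moves the
  entry at \<open>(i, j)\<close> to \<open>(\<pi> i, \<pi> j)\<close>; hence the inverse permutation in the formula.
\<close>

definition perm_act :: "(nat \<Rightarrow> nat) \<Rightarrow> imat \<Rightarrow> imat" where
  "perm_act \<pi> M = (\<lambda>a b. M (inv' \<pi> a) (inv' \<pi> b))"

lemma perm_act_mat_unit:
  assumes "\<pi> permutes S"
  shows "perm_act \<pi> (mat_unit i j) = mat_unit (\<pi> i) (\<pi> j)"
  using permutes_inv_eq[OF assms] by (auto simp: perm_act_def mat_unit_def fun_eq_iff)

lemma perm_act_plus: "perm_act \<pi> (mat_plus M N) = mat_plus (perm_act \<pi> M) (perm_act \<pi> N)"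
  by (simp add: perm_act_def mat_plus_def)

definition mat_perm_group :: "nat \<Rightarrow> (imat \<times> (nat \<Rightarrow> nat)) monoid" where
  "mat_perm_group n =
    \<lparr> carrier = zero_diag_mats n \<times> carrier (sym_group n),
      mult = (\<lambda>(M, \<pi>) (M', \<pi>'). (mat_plus M (perm_act \<pi> M'), \<pi> \<otimes>\<^bsub>sym_group n\<^esub> \<pi>')),
      one = (\<lambda>a b. 0, \<one>\<^bsub>sym_group n\<^esub>) \<rparr>"

lemma perm_act_id: "perm_act id M = M"
  by (simp add: perm_act_def)

lemma perm_act_comp:
  "\<pi> permutes S \<Longrightarrow> \<rho> permutes S \<Longrightarrow> perm_act (\<pi> \<circ> \<rho>) M = perm_act \<pi> (perm_act \<rho> M)"
  by (simp add: perm_act_def permutes_bij o_inv_distrib)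

lemma perm_act_closed:
  assumes "\<pi> permutes {1..n}" "M \<in> zero_diag_mats n"
  shows "perm_act \<pi> M \<in> zero_diag_mats n"
  using assms permutes_in_image[OF permutes_inv[OF assms(1)]]
  unfolding zero_diag_mats_def perm_act_def by blast

lemma mat_plus_closed:
  assumes "M \<in> zero_diag_mats n" "N \<in> zero_diag_mats n"
  shows "mat_plus M N \<in> zero_diag_mats n"
proof -
  have "M a b \<noteq> 0 \<or> N a b \<noteq> 0" if "M a b + N a b \<noteq> 0" for a b
    using that by auto
  then show ?thesis
    using assms unfolding zero_diag_mats_def mat_plus_def by fastforce
qed

lemma group_mat_perm_group: "group (mat_perm_group n)"
proof (rule groupI)
  fix x assume "x \<in> carrier (mat_perm_group n)"
  then obtain M \<pi> where x: "x = (M, \<pi>)" "M \<in> zero_diag_mats n" "\<pi> permutes {1..n}"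
    by (auto simp: mat_perm_group_def sym_group_carrier)
  have inv: "inv' \<pi> permutes {1..n}"
    using x by (simp add: permutes_inv)
  define N where "N = perm_act (inv' \<pi>) (\<lambda>a b. - M a b)"
  have "(\<lambda>a b. - M a b) \<in> zero_diag_mats n"
    using x(2) by (auto simp: zero_diag_mats_def)
  then have "N \<in> zero_diag_mats n"
    unfolding N_def by (rule perm_act_closed[OF inv])
  then show "\<exists>y\<in>carrier (mat_perm_group n). y \<otimes>\<^bsub>mat_perm_group n\<^esub> x = \<one>\<^bsub>mat_perm_group n\<^esub>"
    using x inv
    by (intro bexI[of _ "(N, inv' \<pi>)"])
      (auto simp: mat_perm_group_def sym_group_def N_def mat_plus_def perm_act_def
        permutes_inv_o fun_eq_iff)
next
  fix x y assume "x \<in> carrier (mat_perm_group n)" "y \<in> carrier (mat_perm_group n)"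
  then show "x \<otimes>\<^bsub>mat_perm_group n\<^esub> y \<in> carrier (mat_perm_group n)"
    by (auto simp: mat_perm_group_def sym_group_def
        intro!: mat_plus_closed perm_act_closed permutes_compose simp del: One_nat_def)
next
  show "\<one>\<^bsub>mat_perm_group n\<^esub> \<in> carrier (mat_perm_group n)"
    by (simp add: mat_perm_group_def sym_group_def zero_diag_mats_def permutes_id)
next
  fix x y z
  assume "x \<in> carrier (mat_perm_group n)" "y \<in> carrier (mat_perm_group n)"
    "z \<in> carrier (mat_perm_group n)"
  then show "x \<otimes>\<^bsub>mat_perm_group n\<^esub> y \<otimes>\<^bsub>mat_perm_group n\<^esub> z =
      x \<otimes>\<^bsub>mat_perm_group n\<^esub> (y \<otimes>\<^bsub>mat_perm_group n\<^esub> z)"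
    by (clarsimp simp: mat_perm_group_def sym_group_def perm_act_plus perm_act_comp comp_assoc)
      (simp add: mat_plus_def add.assoc)
next
  fix x assume "x \<in> carrier (mat_perm_group n)"
  then show "\<one>\<^bsub>mat_perm_group n\<^esub> \<otimes>\<^bsub>mat_perm_group n\<^esub> x = x"
    by (auto simp: mat_perm_group_def sym_group_def perm_act_id mat_plus_def)
qed

section \<open>The super-Gauss-Epple homomorphism\<close>

definition SGE :: "nat \<Rightarrow> braid_word set \<Rightarrow> imat \<times> (nat \<Rightarrow> nat)" where
  "SGE n = braid_hom n (mat_perm_group n)
     (\<lambda>i. (mat_unit i (i + 1), Transposition.transpose i (i + 1)))"

lemma braid_images_SGE:
  "braid_images (mat_perm_group n) n
     (\<lambda>i. (mat_unit i (i + 1), Transposition.transpose i (i + 1)))"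
proof -
  interpret group "mat_perm_group n" by (rule group_mat_perm_group)
  have act: "perm_act (Transposition.transpose i j) (mat_unit k l) =
      mat_unit (Transposition.transpose i j k) (Transposition.transpose i j l)" for i j k l
    by (rule perm_act_mat_unit[where S = UNIV]) (simp add: permutes_swap_id)
  show ?thesis
  proof unfold_locales
    fix i assume "i \<in> {1..<n}"
    then show "(mat_unit i (i + 1), Transposition.transpose i (i + 1)) \<in> carrier (mat_perm_group n)"
      by (auto simp: mat_perm_group_def sym_group_def zero_diag_mats_def mat_unit_def
          intro!: permutes_swap_id split: if_splits)
  next
    fix i j :: nat assume "i + 1 < j"
    then show "(mat_unit i (i + 1), Transposition.transpose i (i + 1)) \<otimes>\<^bsub>mat_perm_group n\<^esub>
          (mat_unit j (j + 1), Transposition.transpose j (j + 1)) =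
        (mat_unit j (j + 1), Transposition.transpose j (j + 1)) \<otimes>\<^bsub>mat_perm_group n\<^esub>
          (mat_unit i (i + 1), Transposition.transpose i (i + 1))"
      by (simp add: mat_perm_group_def sym_group_mult act transpose_far_commute[symmetric] mat_plus_def add.commute)
  qed (simp add: mat_perm_group_def sym_group_mult act perm_act_plus transpose_braid,
      simp add: mat_plus_def add_ac)
qed

lemmas SGE_hom = braid_images.braid_hom_props(1)[OF braid_images_SGE, folded SGE_def]
lemmas SGE_gen = braid_images.braid_hom_props(2)[OF braid_images_SGE, folded SGE_def]

lemma snd_SGE:
  assumes "\<beta> \<in> carrier (braid_group n)"
  shows "snd (SGE n \<beta>) = braid_perm n \<beta>"
proof -
  interpret P: braid_images "sym_group n" n "\<lambda>i. Transposition.transpose i (i + 1)"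
    by (rule braid_images_perm)
  have "(\<lambda>\<beta>. snd (SGE n \<beta>)) \<in> hom (braid_group n) (sym_group n)"
    using SGE_hom[of n]
    by (fastforce simp: hom_def mat_perm_group_def Pi_iff split: prod.splits)
  then show ?thesis
    using assms P.braid_hom_unique[of "\<lambda>\<beta>. snd (SGE n \<beta>)"] P.braid_hom_unique[of "braid_perm n"]
    by (elim braid_carrierE) (simp add: SGE_gen braid_perm_hom braid_perm_gen)
qed

definition F :: "nat \<Rightarrow> braid_word set \<Rightarrow> imat" where
  "F n \<beta> = (\<lambda>a b. fst (SGE n \<beta>) a b - fst (SGE n \<beta>) b a)"

text \<open>The matrix that \<open>F\<close> takes on all braids with permutation \<open>\<rho>\<close>.\<close>

definition F_bar :: "nat \<Rightarrow> (nat \<Rightarrow> nat) \<Rightarrow> imat" where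
  "F_bar n \<rho> = (THE A. \<forall>\<beta>\<in>carrier (braid_group n). braid_perm n \<beta> = \<rho> \<longrightarrow> F n \<beta> = A)"

end

theory Submission
  imports Defs
begin

text \<open>
  Write \<open>s\<close> for the permutation of the braid \<open>\<beta>\<close>. The map \<open>F\<close> is a 1-cocycle of the braid
  group with values in integer matrices: \<open>F (\<beta> \<gamma>) = F \<beta> + s \<cdot> F \<gamma>\<close>, because transposing a
  matrix commutes with the action of permutations. The reason for everything else is that this
  cocycle is the coboundary of the strictly upper triangular matrix \<open>L\<close> with entries
  \<open>L a b = [a < b]\<close>, that is, \<open>F \<beta> = L - s \<cdot> L\<close>. As both sides are cocycles, this needs to be
  compared only on Artin generators, where it says that an adjacent transposition \<open>(i, i + 1)\<close>
  changes the order of no pair except \<open>i, i + 1\<close>.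

  The right-hand side mentions \<open>\<beta>\<close> only through \<open>s\<close>, and every permutation is the permutation
  of some braid, so \<open>F_bar n \<rho> = L - \<rho> \<cdot> L\<close>. For \<open>i < j\<close> its entry at \<open>(i, j)\<close> is 1 minus a
  truth value: it is 1 exactly when \<open>\<rho>\<close> inverts the pair, meaning that the inverse of \<open>\<rho>\<close>
  reverses the order of \<open>i\<close> and \<open>j\<close>.
\<close>

section \<open>Generation by the Artin generators\<close>

lemma inv_artin_gen:
  assumes "i \<in> {1..<n}"
  shows "inv\<^bsub>braid_group n\<^esub> artin_gen n i = braid_rel n `` {[(i, False)]}"
proof (rule group.inv_equality[OF group_braid_group])
  show "braid_rel n `` {[(i, False)]} \<otimes>\<^bsub>braid_group n\<^esub> artin_gen n i = \<one>\<^bsub>braid_group n\<^esub>"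
    using assms braid_rel.cancel[OF assms, of False]
    by (simp add: artin_gen_def braid_mult_class braid_one_class braid_class_eq_iff)
qed (use assms in \<open>simp_all add: artin_gen_def braid_class_carrier\<close>)

lemma artin_gen_carrier: "i \<in> {1..<n} \<Longrightarrow> artin_gen n i \<in> carrier (braid_group n)"
  by (simp add: artin_gen_def braid_class_carrier)

text \<open>
  A braid is represented by a word, and the class of a one-letter word is a generator or the
  inverse of one; hence a property passing to products and inverses can be checked on generators.
\<close>

lemma braid_group_induct [consumes 1, case_names one gen inverse mult]:
  assumes "\<beta> \<in> carrier (braid_group n)"
    and one: "P \<one>\<^bsub>braid_group n\<^esub>"
    and gen: "\<And>i. i \<in> {1..<n} \<Longrightarrow> P (artin_gen n i)"
    and inverse: "\<And>\<beta>. \<beta> \<in> carrier (braid_group n) \<Longrightarrow> P \<beta> \<Longrightarrow> P (inv\<^bsub>braid_group n\<^esub> \<beta>)"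
    and mult: "\<And>\<beta> \<gamma>. \<beta> \<in> carrier (braid_group n) \<Longrightarrow> \<gamma> \<in> carrier (braid_group n) \<Longrightarrow>
      P \<beta> \<Longrightarrow> P \<gamma> \<Longrightarrow> P (\<beta> \<otimes>\<^bsub>braid_group n\<^esub> \<gamma>)"
  shows "P \<beta>"
proof -
  have "P (braid_rel n `` {u})" if "u \<in> braid_words n" for u
    using that
  proof (induction u)
    case Nil
    then show ?case using one by (simp add: braid_one_class)
  next
    case (Cons x u)
    obtain i e where x: "x = (i, e)" by (cases x)
    have i: "i \<in> {1..<n}" and u: "u \<in> braid_words n"
      using Cons.prems x by auto
    have "P (braid_rel n `` {[x]})"
    proof (cases e)
      case True
      then show ?thesis using gen[OF i] x by (simp add: artin_gen_def)
    next
      case False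
      then show ?thesis
        using inverse[OF artin_gen_carrier[OF i] gen[OF i]] x by (simp add: inv_artin_gen[OF i])
    qed
    then have "P (braid_rel n `` {[x]} \<otimes>\<^bsub>braid_group n\<^esub> braid_rel n `` {u})"
      using i u x Cons.IH[OF u] by (intro mult) (simp_all add: braid_class_carrier)
    then show ?case using i u x by (simp add: braid_mult_class)
  qed
  then show ?thesis using assms(1) by (auto elim: braid_carrierE)
qed

section \<open>Every permutation comes from a braid\<close>

lemma braid_perm_mult:
  "\<beta> \<in> carrier (braid_group n) \<Longrightarrow> \<gamma> \<in> carrier (braid_group n) \<Longrightarrow>
    braid_perm n (\<beta> \<otimes>\<^bsub>braid_group n\<^esub> \<gamma>) = braid_perm n \<beta> \<circ> braid_perm n \<gamma>"
  using hom_mult[OF braid_perm_hom] by (simp add: sym_group_mult)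

lemma braid_perm_one: "braid_perm n \<one>\<^bsub>braid_group n\<^esub> = id"
  using hom_one[OF braid_perm_hom group_braid_group sym_group_is_group] by (simp add: sym_group_one)

lemma braid_perm_permutes: "\<beta> \<in> carrier (braid_group n) \<Longrightarrow> braid_perm n \<beta> permutes {1..n}"
  using hom_in_carrier[OF braid_perm_hom] by (simp add: sym_group_carrier)

lemma comp_in_braid_perm_image:
  assumes "\<pi> \<in> braid_perm n ` carrier (braid_group n)" "\<tau> \<in> braid_perm n ` carrier (braid_group n)"
  shows "\<pi> \<circ> \<tau> \<in> braid_perm n ` carrier (braid_group n)"
proof -
  interpret group "braid_group n" by (rule group_braid_group)
  show ?thesis using assms by (auto simp flip: braid_perm_mult)
qed

text \<open>A long transposition is an adjacent one conjugating a shorter one.\<close>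

lemma transpose_in_braid_perm_image:
  assumes "1 \<le> a" "a < b" "b \<le> n"
  shows "Transposition.transpose a b \<in> braid_perm n ` carrier (braid_group n)"
proof -
  have adjacent: "Transposition.transpose i (Suc i) \<in> braid_perm n ` carrier (braid_group n)"
    if "i \<in> {1..<n}" for i
    using braid_perm_gen[OF that] artin_gen_carrier[OF that] by (metis Suc_eq_plus1 imageI)
  have "Suc a \<le> b" using assms by simp
  then show ?thesis
    using \<open>b \<le> n\<close>
  proof (induction b rule: dec_induct)
    case base
    then show ?case using adjacent[of a] assms(1) by simp
  next
    case (step b)
    have long: "Transposition.transpose a (Suc b) = Transposition.transpose b (Suc b) \<circ>
        (Transposition.transpose a b \<circ> Transposition.transpose b (Suc b))"
      using step.hyps by (auto simp: fun_eq_iff Transposition.transpose_def)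
    have b: "b \<in> {1..<n}" "b \<le> n" using step.hyps step.prems by simp_all
    show ?case
      unfolding long by (intro comp_in_braid_perm_image adjacent[OF b(1)] step.IH b(2))
  qed
qed

lemma braid_perm_surj:
  assumes "\<rho> permutes {1..n}"
  shows "\<rho> \<in> braid_perm n ` carrier (braid_group n)"
proof -
  interpret group "braid_group n" by (rule group_braid_group)
  have id: "id \<in> braid_perm n ` carrier (braid_group n)"
    using braid_perm_one[of n] one_closed by (metis imageI)
  show ?thesis
    using finite_atLeastAtMost assms
  proof (induction rule: permutes_rev_induct)
    case id
    show ?case by (rule \<open>id \<in> _\<close>)
  next
    case (swap a b p)
    have "Transposition.transpose a b \<in> braid_perm n ` carrier (braid_group n)"
      using swap.hyps id transpose_in_braid_perm_image[of a b n] transpose_in_braid_perm_image[of b a n]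
      by (cases a b rule: linorder_cases) (auto simp: transpose_commute)
    then show ?case
      using swap.IH by (intro comp_in_braid_perm_image)
  qed
qed

section \<open>The cocycle and its potential\<close>

text \<open>
  The potential is not cut off at size \<open>n\<close>, so that it serves all braid groups at once; the
  surplus entries cancel in the coboundary of a permutation of \<open>{1..n}\<close>, which maps no point
  across the boundary of this interval.
\<close>

definition upper_triangle :: imat where
  "upper_triangle a b = of_bool (a < b)"

definition coboundary :: "(nat \<Rightarrow> nat) \<Rightarrow> imat" where
  "coboundary \<pi> = (\<lambda>a b. upper_triangle a b - perm_act \<pi> upper_triangle a b)"

lemma F_mult:
  assumes "\<beta> \<in> carrier (braid_group n)" "\<gamma> \<in> carrier (braid_group n)"
  shows "F n (\<beta> \<otimes>\<^bsub>braid_group n\<^esub> \<gamma>) = mat_plus (F n \<beta>) (perm_act (braid_perm n \<beta>) (F n \<gamma>))"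
proof -
  have "fst (SGE n (\<beta> \<otimes>\<^bsub>braid_group n\<^esub> \<gamma>)) =
      mat_plus (fst (SGE n \<beta>)) (perm_act (braid_perm n \<beta>) (fst (SGE n \<gamma>)))"
    using hom_mult[OF SGE_hom assms] snd_SGE[OF assms(1)]
    by (auto simp: mat_perm_group_def split: prod.splits)
  then show ?thesis
    by (simp add: F_def mat_plus_def perm_act_def fun_eq_iff)
qed

text \<open>The sum telescopes: \<open>L - \<pi> \<cdot> L\<close> and \<open>\<pi> \<cdot> L - \<pi> \<cdot> \<tau> \<cdot> L\<close> share their middle term.\<close>

lemma coboundary_comp:
  assumes "\<pi> permutes S" "\<tau> permutes S"
  shows "coboundary (\<pi> \<circ> \<tau>) = mat_plus (coboundary \<pi>) (perm_act \<pi> (coboundary \<tau>))"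
  unfolding coboundary_def perm_act_comp[OF assms] by (simp add: mat_plus_def perm_act_def)

lemma coboundary_id: "coboundary id = (\<lambda>a b. 0)"
  by (simp add: coboundary_def perm_act_id)

lemma F_one: "F n \<one>\<^bsub>braid_group n\<^esub> = (\<lambda>a b. 0)"
  using hom_one[OF SGE_hom group_braid_group group_mat_perm_group]
  by (simp add: F_def mat_perm_group_def)

lemma F_artin_gen:
  assumes "i \<in> {1..<n}"
  shows "F n (artin_gen n i) = coboundary (Transposition.transpose i (i + 1))"
  using SGE_gen[OF assms]
  by (auto simp: F_def coboundary_def upper_triangle_def perm_act_def mat_unit_def fun_eq_iff
      Transposition.transpose_def)

lemma perm_act_cancel:
  assumes "\<pi> permutes S" "perm_act \<pi> M = perm_act \<pi> N"
  shows "M = N"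
proof -
  have "perm_act (inv' \<pi>) (perm_act \<pi> M) = perm_act (inv' \<pi>) (perm_act \<pi> N)"
    using assms(2) by simp
  then show ?thesis
    using assms(1)
    by (simp add: permutes_inv perm_act_id permutes_inv_o(2) flip: perm_act_comp[where S = S])
qed

lemma F_eq_coboundary:
  assumes "\<beta> \<in> carrier (braid_group n)"
  shows "F n \<beta> = coboundary (braid_perm n \<beta>)"
  using assms
proof (induction rule: braid_group_induct)
  case one
  show ?case unfolding F_one braid_perm_one coboundary_id ..
next
  case (gen i)
  then show ?case by (simp add: F_artin_gen braid_perm_gen)
next
  case (mult \<beta> \<gamma>)
  note perms = braid_perm_permutes[OF mult.hyps(1)] braid_perm_permutes[OF mult.hyps(2)]
  show ?case
    unfolding F_mult[OF mult.hyps] braid_perm_mult[OF mult.hyps] coboundary_comp[OF perms] mult.IH ..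
next
  case (inverse \<beta>)
  interpret group "braid_group n" by (rule group_braid_group)
  let ?\<gamma> = "inv\<^bsub>braid_group n\<^esub> \<beta>"
  have \<gamma>: "?\<gamma> \<in> carrier (braid_group n)" using inverse.hyps by simp
  note perms = braid_perm_permutes[OF inverse.hyps] braid_perm_permutes[OF \<gamma>]
  \<comment> \<open>Both cocycles vanish on the product of \<open>\<beta>\<close> with its inverse, and agree on \<open>\<beta>\<close>.\<close>
  have "mat_plus (F n \<beta>) (perm_act (braid_perm n \<beta>) (F n ?\<gamma>)) = (\<lambda>a b. 0)"
    using F_mult[OF inverse.hyps \<gamma>] inverse.hyps by (simp add: F_one)
  moreover have "mat_plus (coboundary (braid_perm n \<beta>))
      (perm_act (braid_perm n \<beta>) (coboundary (braid_perm n ?\<gamma>))) = (\<lambda>a b. 0)"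
    unfolding coboundary_comp[OF perms, symmetric] braid_perm_mult[OF inverse.hyps \<gamma>, symmetric]
      r_inv[OF inverse.hyps] braid_perm_one coboundary_id ..
  ultimately have "perm_act (braid_perm n \<beta>) (F n ?\<gamma>) =
      perm_act (braid_perm n \<beta>) (coboundary (braid_perm n ?\<gamma>))"
    using inverse.IH by (simp add: mat_plus_def fun_eq_iff) (metis add_left_cancel)
  then show ?case
    by (rule perm_act_cancel[OF perms(1)])
qed

lemma F_bar_eq_coboundary:
  assumes "\<rho> \<in> carrier (sym_group n)"
  shows "F_bar n \<rho> = coboundary \<rho>"
proof -
  \<comment> \<open>A braid over \<open>\<rho>\<close> is what makes the matrix in the definite description unique.\<close>
  obtain \<beta> where "\<beta> \<in> carrier (braid_group n)" "braid_perm n \<beta> = \<rho>"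
    using braid_perm_surj assms by (auto simp: sym_group_carrier)
  then show ?thesis
    unfolding F_bar_def by (intro the_equality) (auto simp: F_eq_coboundary)
qed

theorem theorem4p2:
  fixes n i j :: nat and \<rho> :: "nat \<Rightarrow> nat"
  assumes "n \<ge> 2"
    and "\<rho> \<in> carrier (sym_group n)"
    and "i \<in> {1..n}" and "j \<in> {1..n}" and "i < j"
  shows "F_bar n \<rho> i j \<in> {0, 1}"
  using assms(5)
  by (simp add: F_bar_eq_coboundary[OF assms(2)] coboundary_def upper_triangle_def perm_act_def)

end
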